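(* Let $n\ge 0$ be an integer, let $a_1\le\cdots\le a_n$ be real numbers, and let $p,q\ge 1$ be integers. For $x,y\in\mathbb{R}$ put $$K_n(x,y):=\exp[a_1,\dots,a_n,x^{(p)},y^{(q)}],$$ the divided difference of the exponential function at the $n+p+q$ nodes consisting of $a_1,\dots,a_n$, the node $x$ repeated $p$ times and the node $y$ repeated $q$ times. Then for all real $x_1\le x_2$ and $y_1\le y_2$, $$K_n(x_1,y_1)\,K_n(x_2,y_2)\ \le\ K_n(x_1,y_2)\,K_n(x_2,y_1).$$
   Context: $\exp[z_0,\dots,z_m]$ denotes the divided difference of the function $e^x$ at the nodes $z_0,\dots,z_m$. It is symmetric in the nodes; for pairwise distinct nodes it equals $\sum_{i=0}^m e^{z_i}/\prod_{j\ne i}(z_i-z_j)$, and for repeated nodes it is defined by continuous extension, equivalently by the contour integral $\frac{1}{2\pi i}\oint_\Gamma \frac{e^z}{\prod_{i=0}^m (z-z_i)}\,dz$ with $\Gamma$ a positively oriented contour enclosing all nodes. Superscripts in parentheses indicate multiplicities of nodes. For $n=0$ there are no nodes $a_i$. *)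

theory Defs
  imports "HOL-Complex_Analysis.Complex_Analysis"
begin

(* The divided difference exp[z_0,...,z_m], repeated nodes allowed. The circle about 0 is one
   particular contour enclosing all nodes; by exp_dd_contour below any other one gives the same
   value. *)
definition exp_dd :: "complex list \<Rightarrow> complex" where
  "exp_dd zs = 1 / (2 * of_real pi * \<i>) *
     contour_integral (circlepath 0 (1 + (\<Sum>w\<leftarrow>zs. norm w)))
       (\<lambda>z. exp z / (\<Prod>w\<leftarrow>zs. z - w))"

(* Taking Re loses nothing: see of_real_exp_dd_real. *)
definition exp_dd_real :: "real list \<Rightarrow> real" where
  "exp_dd_real xs = Re (exp_dd (map of_real xs))"

definition K :: "nat \<Rightarrow> (nat \<Rightarrow> real) \<Rightarrow> nat \<Rightarrow> nat \<Rightarrow> real \<Rightarrow> real \<Rightarrow> real" where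
  "K n a p q x y = exp_dd_real (map a [1..<Suc n] @ replicate p x @ replicate q y)"

lemma norm_less_exp_dd_radius:
  fixes zs :: "complex list"
  assumes "w \<in> set zs"
  shows "norm w < 1 + (\<Sum>w\<leftarrow>zs. norm w)"
proof -
  have "norm w \<le> (\<Sum>w\<leftarrow>zs. norm w)"
    using assms by (intro member_le_sum_list) auto
  then show ?thesis by simp
qed

lemma exp_dd_radius_pos: "0 < 1 + (\<Sum>w\<leftarrow>zs. norm (w :: complex))"
  by (intro add_pos_nonneg sum_list_nonneg) auto

lemma contour_integral_enclosing:
  assumes "valid_path \<gamma>" "pathfinish \<gamma> = pathstart \<gamma>"
    and "path_image \<gamma> \<inter> set zs = {}"
    and "\<And>w. w \<in> set zs \<Longrightarrow> winding_number \<gamma> w = 1"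
  shows "contour_integral \<gamma> (\<lambda>z. exp z / (\<Prod>w\<leftarrow>zs. z - w)) =
    2 * of_real pi * \<i> * (\<Sum>w\<in>set zs. residue (\<lambda>z. exp z / (\<Prod>w\<leftarrow>zs. z - w)) w)"
proof -
  have prod_holo: "(\<lambda>z. \<Prod>w\<leftarrow>ws. z - w) holomorphic_on S" for ws :: "complex list" and S
    by (induction ws) (auto intro!: holomorphic_intros)
  have nz: "(\<Prod>w\<leftarrow>zs. z - w) \<noteq> 0" if "z \<notin> set zs" for z
    using that by (auto simp: prod_list_zero_iff)
  have "(\<lambda>z. exp z / (\<Prod>w\<leftarrow>zs. z - w)) holomorphic_on UNIV - set zs"
    using nz by (intro holomorphic_intros prod_holo) auto
  then have "contour_integral \<gamma> (\<lambda>z. exp z / (\<Prod>w\<leftarrow>zs. z - w)) = 2 * pi * \<i> *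
      (\<Sum>w\<in>set zs. winding_number \<gamma> w * residue (\<lambda>z. exp z / (\<Prod>w\<leftarrow>zs. z - w)) w)"
    using assms(1-3) by (intro Residue_theorem[of UNIV]) auto
  then show ?thesis using assms(4) by simp
qed

lemma exp_dd_eq_residues:
  "exp_dd zs = (\<Sum>w\<in>set zs. residue (\<lambda>z. exp z / (\<Prod>w\<leftarrow>zs. z - w)) w)"
proof -
  let ?R = "1 + (\<Sum>w\<leftarrow>zs. norm w)"
  have "path_image (circlepath 0 ?R) \<inter> set zs = {}"
    using norm_less_exp_dd_radius[of _ zs] exp_dd_radius_pos[of zs] by (fastforce simp: dist_norm)
  moreover have "winding_number (circlepath 0 ?R) w = 1" if "w \<in> set zs" for w
    using norm_less_exp_dd_radius[OF that] by (intro winding_number_circlepath) auto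
  ultimately show ?thesis
    unfolding exp_dd_def by (subst contour_integral_enclosing) auto
qed

lemma exp_dd_contour:
  assumes "valid_path \<gamma>" "pathfinish \<gamma> = pathstart \<gamma>"
    and "path_image \<gamma> \<inter> set zs = {}"
    and "\<And>w. w \<in> set zs \<Longrightarrow> winding_number \<gamma> w = 1"
  shows "exp_dd zs =
    1 / (2 * of_real pi * \<i>) * contour_integral \<gamma> (\<lambda>z. exp z / (\<Prod>w\<leftarrow>zs. z - w))"
  using contour_integral_enclosing[OF assms] by (simp add: exp_dd_eq_residues)

lemma exp_dd_distinct:
  assumes "distinct zs"
  shows "exp_dd zs = (\<Sum>i<length zs. exp (zs ! i) / (\<Prod>j\<in>{..<length zs} - {i}. zs ! i - zs ! j))"
proof -
  have prod: "(\<Prod>w\<leftarrow>zs. z - w) = (\<Prod>w\<in>set zs. z - w)" for z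
    using assms by (simp add: prod.distinct_set_conv_list)
  have res: "residue (\<lambda>z. exp z / (\<Prod>w\<leftarrow>zs. z - w)) v = exp v / (\<Prod>w\<in>set zs - {v}. v - w)"
    if v: "v \<in> set zs" for v
  proof -
    have "(\<lambda>z. exp z / (\<Prod>w\<leftarrow>zs. z - w)) =
        (\<lambda>z. (exp z / (\<Prod>w\<in>set zs - {v}. z - w)) / (z - v))"
      using v by (auto simp: prod prod.remove[of "set zs" v] field_simps)
    moreover have "residue (\<lambda>z. (exp z / (\<Prod>w\<in>set zs - {v}. z - w)) / (z - v)) v =
        exp v / (\<Prod>w\<in>set zs - {v}. v - w)"
    proof (rule residue_simple)
      show "open (- (set zs - {v}))" by (intro open_Compl finite_imp_closed) auto
      show "(\<lambda>z. exp z / (\<Prod>w\<in>set zs - {v}. z - w)) holomorphic_on - (set zs - {v})"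
        by (intro holomorphic_intros) auto
    qed auto
    ultimately show ?thesis by simp
  qed
  have bij: "bij_betw (nth zs) {..<length zs} (set zs)"
    using assms by (intro bij_betw_nth) auto
  have "exp_dd zs = (\<Sum>v\<in>set zs. exp v / (\<Prod>w\<in>set zs - {v}. v - w))"
    by (simp add: exp_dd_eq_residues res)
  also have "\<dots> = (\<Sum>i<length zs. exp (zs ! i) / (\<Prod>w\<in>set zs - {zs ! i}. zs ! i - w))"
    by (rule sum.reindex_bij_betw[OF bij, symmetric])
  also have "\<dots> = (\<Sum>i<length zs. exp (zs ! i) / (\<Prod>j\<in>{..<length zs} - {i}. zs ! i - zs ! j))"
  proof (rule sum.cong[OF refl])
    fix i assume i: "i \<in> {..<length zs}"
    have "bij_betw (nth zs) ({..<length zs} - {i}) (set zs - {zs ! i})"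
      using bij_betw_DiffI[OF bij, of "{i}" "{zs ! i}"] i by (simp add: bij_betw_def)
    then show "exp (zs ! i) / (\<Prod>w\<in>set zs - {zs ! i}. zs ! i - w) =
        exp (zs ! i) / (\<Prod>j\<in>{..<length zs} - {i}. zs ! i - zs ! j)"
      by (subst prod.reindex_bij_betw[symmetric]) auto
  qed
  finally show ?thesis .
qed

lemma of_real_exp_dd_real: "of_real (exp_dd_real xs) = exp_dd (map of_real xs)"
proof -
  let ?zs = "map of_real xs :: complex list"
  let ?R = "1 + (\<Sum>w\<leftarrow>?zs. norm w)"
  let ?f = "\<lambda>z. exp z / (\<Prod>w\<leftarrow>?zs. z - w)"
  have path: "cnj \<circ> circlepath 0 ?R = reversepath (circlepath 0 ?R)"
  proof
    fix t :: real
    have "exp (\<i> * linepath (of_real 0) (- (2 * of_real pi)) t) =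
        exp (\<i> * linepath (of_real 0) (- (2 * of_real pi)) t) * exp (2 * of_real pi * \<i>)"
      by simp
    also have "\<dots> = exp (\<i> * linepath (2 * of_real pi) (of_real 0) t)"
      unfolding exp_add[symmetric] by (rule arg_cong[of _ _ exp])
        (simp add: linepath_def algebra_simps)
    finally show "(cnj \<circ> circlepath 0 ?R) t = reversepath (circlepath 0 ?R) t"
      by (simp add: circlepath_def part_circlepath_cnj part_circlepath_def linepath_def
            exp_cnj reversepath_def scaleR_conv_of_real)
  qed
  have "cnj (\<Prod>w\<leftarrow>map of_real ys. z - w) = (\<Prod>w\<leftarrow>map of_real ys. cnj z - w)" for z ys
    by (induction ys) auto
  then have f: "cnj \<circ> ?f \<circ> cnj = ?f"
    by (auto simp: fun_eq_iff exp_cnj)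
  have "cnj (contour_integral (circlepath 0 ?R) ?f) =
      contour_integral (cnj \<circ> circlepath 0 ?R) ?f"
    by (subst contour_integral_cnj) (simp_all only: f valid_path_circlepath)
  also have "\<dots> = - contour_integral (circlepath 0 ?R) ?f"
    unfolding path by (intro contour_integral_reversepath) simp
  finally have "cnj (exp_dd ?zs) = exp_dd ?zs"
    unfolding exp_dd_def complex_cnj_mult by simp
  then have "exp_dd ?zs \<in> \<real>"
    by (simp add: Reals_cnj_iff)
  then show ?thesis
    by (simp add: exp_dd_real_def)
qed

end

theory Submission
  imports Defs
begin

text \<open>Since \<open>(1 + z/N)^N\<close> tends to \<open>exp z\<close> uniformly on the contour, the divided difference of
  \<open>exp\<close> at \<open>m + 1\<close> nodes is the limit of \<open>h(1 + z\<^sub>0/N, \<dots>, 1 + z\<^sub>m/N) / N^m\<close>, where \<open>h\<close> is the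
  complete homogeneous symmetric polynomial of degree \<open>N - m\<close>. For large \<open>N\<close> its arguments are
  positive, so it suffices to prove the inequality for \<open>h\<close> at positive arguments. Grouping by the
  degrees \<open>s\<close> in \<open>x\<close> and \<open>t\<close> in \<open>y\<close>, the degree-\<open>N\<close> polynomial is the sum of
  \<open>c s * d t * g (N - s - t) * x^s * y^t\<close>, with \<open>c, d\<close> nonnegative and \<open>g\<close> the sequence of complete
  homogeneous polynomials of the remaining nodes. The sequence \<open>g\<close> is log-concave, so the kernel
  \<open>g (N - s - t)\<close> is reverse regular of order 2, and this survives composition with the totally
  positive kernels \<open>x^s\<close> and \<open>y^t\<close> (Cauchy--Binet).\<close>

unbundle no vec_syntax

section \<open>Complete homogeneous symmetric polynomials as power series coefficients\<close>

text \<open>The factor \<open>1 / (1 - w X)\<close> of the generating function of the complete homogeneous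
  symmetric polynomials is written as a geometric series.\<close>

definition hsym :: "'a::comm_ring_1 list \<Rightarrow> 'a fps" where
  "hsym zs = (\<Prod>w\<leftarrow>zs. Abs_fps (\<lambda>k. w ^ k))"

lemma hsym_Nil [simp]: "hsym [] = 1"
  and hsym_Cons: "hsym (w # zs) = Abs_fps (\<lambda>k. w ^ k) * hsym zs"
  and hsym_append: "hsym (xs @ ys) = hsym xs * hsym ys"
  and hsym_replicate: "hsym (replicate n w) = Abs_fps (\<lambda>k. w ^ k) ^ n"
  by (simp_all add: hsym_def)

lemma hsym_Cons_0: "hsym (w # zs) $ 0 = hsym zs $ 0"
  by (simp add: hsym_Cons fps_mult_nth)

text \<open>Multiplying the series of \<open>w # zs\<close> by \<open>1 - w X\<close> leaves that of
  \<open>zs\<close>; this is the comparison of coefficients.\<close>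

lemma hsym_Cons_Suc: "hsym (w # zs) $ Suc k = w * hsym (w # zs) $ k + hsym zs $ Suc k"
proof -
  have "hsym (w # zs) $ Suc k =
      (\<Sum>i\<le>k. w ^ Suc i * hsym zs $ (k - i)) + hsym zs $ Suc k"
    unfolding hsym_Cons fps_mult_nth atLeast0AtMost
    by (subst sum.atMost_Suc_shift) simp
  also have "(\<Sum>i\<le>k. w ^ Suc i * hsym zs $ (k - i)) = w * hsym (w # zs) $ k"
    by (simp add: hsym_Cons fps_mult_nth atLeast0AtMost sum_distrib_left mult.assoc)
  finally show ?thesis .
qed

lemma hsym_of_real:
  "hsym (map of_real zs) $ k = (of_real (hsym zs $ k) :: 'a::{real_algebra_1, comm_ring_1})"
  by (induction zs arbitrary: k) (simp_all add: hsym_Cons fps_mult_nth)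

text \<open>The substitution of \<open>w X\<close> for \<open>X\<close> in
  \<open>1 / (1 - X)^n\<close>. It splits the contribution of a repeated node into a nonnegative
  constant and a pure power of the node.\<close>

lemma geometric_power_nth:
  "(Abs_fps (\<lambda>k. w ^ k) ^ n) $ k = (Abs_fps (\<lambda>_. 1) ^ n) $ k * (w::'a::comm_ring_1) ^ k"
proof (induction n arbitrary: k)
  case 0
  then show ?case by simp
next
  case (Suc n)
  have "w ^ i * (c * w ^ (k - i)) = c * w ^ k" if "i \<le> k" for i and c :: 'a
    using that by (metis (no_types) le_add_diff_inverse mult.left_commute power_add)
  then show ?case
    by (auto simp: fps_mult_nth Suc sum_distrib_right intro!: sum.cong)
qed

section \<open>Log-concave sequences\<close>

text \<open>Log-concavity without internal zeros, in a form free of division.\<close>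

definition pf2 :: "(nat \<Rightarrow> real) \<Rightarrow> bool" where
  "pf2 g \<longleftrightarrow> (\<forall>i. 0 \<le> g i) \<and> (\<forall>i j d. i \<le> j \<longrightarrow> g i * g (j + d) \<le> g (i + d) * g j)"

text \<open>A shift by \<open>d\<close> is a chain of unit steps: each raises the smaller index and
  lowers the larger one. If the chain reaches \<open>i = j\<close>, both sides agree.\<close>

lemma pf2I:
  assumes "\<And>i. 0 \<le> g i" and step: "\<And>i j. i \<le> j \<Longrightarrow> g i * g (Suc j) \<le> g (Suc i) * g j"
  shows "pf2 g"
proof -
  have "g i * g (j + d) \<le> g (i + d) * g j" if "i \<le> j" for i j d
    using that
  proof (induction d arbitrary: i)
    case (Suc d)
    show ?case
    proof (cases "i = j")
      case False
      have "g i * g (j + Suc d) \<le> g (Suc i) * g (j + d)"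
        using step[of i "j + d"] Suc.prems by simp
      also have "\<dots> \<le> g (Suc i + d) * g j"
        using Suc.IH[of "Suc i"] Suc.prems False by simp
      finally show ?thesis by simp
    qed (simp add: mult.commute)
  qed simp
  with assms(1) show ?thesis by (simp add: pf2_def)
qed

text \<open>By the recursion for \<open>g'\<close>, the common term \<open>w * g' i * g' j\<close>
  cancels from the unit-step inequality. What remains,
  \<open>g' i * g (Suc j) \<le> g (Suc i) * g' j\<close>, follows termwise from log-concavity of
  \<open>g\<close>.\<close>

lemma pf2_hsym:
  assumes "\<And>w. w \<in> set zs \<Longrightarrow> 0 \<le> w"
  shows "pf2 (\<lambda>k. hsym zs $ k)"
  using assms
proof (induction zs)
  case Nil
  show ?case by (rule pf2I) auto
next
  case (Cons w zs)
  define g where "g = (\<lambda>k. hsym zs $ k)"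
  define g' where "g' = (\<lambda>k. hsym (w # zs) $ k)"
  have w: "0 \<le> w" using Cons.prems by simp
  have "pf2 g" unfolding g_def using Cons by simp
  then have g0: "0 \<le> g i" and g: "i \<le> j \<Longrightarrow> g i * g (j + d) \<le> g (i + d) * g j" for i j d
    by (auto simp: pf2_def)
  have g'_sum: "g' k = (\<Sum>i\<le>k. w ^ i * g (k - i))" for k
    by (simp add: g'_def g_def hsym_Cons fps_mult_nth atLeast0AtMost)
  have g'_Suc: "g' (Suc k) = w * g' k + g (Suc k)" for k
    by (simp add: g'_def g_def hsym_Cons_Suc)
  have "pf2 g'"
  proof (rule pf2I)
    show "0 \<le> g' i" for i
      unfolding g'_sum using w g0 by (intro sum_nonneg mult_nonneg_nonneg) auto
    fix i j :: nat assume ij: "i \<le> j"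
    have "g' i * g (Suc j) = (\<Sum>k\<le>i. w ^ k * (g (i - k) * g (Suc j)))"
      by (simp add: g'_sum sum_distrib_right mult.assoc)
    also have "\<dots> \<le> (\<Sum>k\<le>i. w ^ k * (g (Suc i) * g (j - k)))"
    proof (intro sum_mono mult_left_mono)
      fix k assume "k \<in> {..i}"
      then show "g (i - k) * g (Suc j) \<le> g (Suc i) * g (j - k)"
        using g[of "i - k" "j - k" "Suc k"] ij by simp
    qed (use w in auto)
    also have "\<dots> \<le> (\<Sum>k\<le>j. w ^ k * (g (Suc i) * g (j - k)))"
      using ij w g0 by (intro sum_mono2) auto
    also have "\<dots> = g (Suc i) * g' j"
      by (simp add: g'_sum sum_distrib_left algebra_simps)
    finally show "g' i * g' (Suc j) \<le> g' (Suc i) * g' j"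
      by (simp add: g'_Suc algebra_simps)
  qed
  then show ?case by (simp add: g'_def)
qed

section \<open>Reverse regularity of order 2\<close>

text \<open>Cauchy--Binet for 2 by 2 determinants: symmetrizing the double sum makes each term a
  product of a minor \<open>m s t\<close> of the coefficients and a minor of the powers, and these
  have opposite signs.\<close>

lemma moment_kernel_reverse:
  fixes f g :: "nat \<Rightarrow> real"
  assumes x: "0 \<le> x1" "x1 \<le> x2"
    and fg: "\<And>s t. s \<le> t \<Longrightarrow> t \<le> N \<Longrightarrow> f s * g t \<le> g s * f t"
  shows "(\<Sum>s\<le>N. f s * x1 ^ s) * (\<Sum>s\<le>N. g s * x2 ^ s) \<le>
    (\<Sum>s\<le>N. g s * x1 ^ s) * (\<Sum>s\<le>N. f s * x2 ^ s)"
proof -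
  define m where "m s t = f s * g t - g s * f t" for s t
  define u where "u s t = x1 ^ s * x2 ^ t" for s t :: nat
  have u: "u t s \<le> u s t" if "s \<le> t" for s t
  proof -
    have "x1 ^ (t - s) * (x1 ^ s * x2 ^ s) \<le> x2 ^ (t - s) * (x1 ^ s * x2 ^ s)"
      using x by (intro mult_right_mono power_mono) auto
    then show ?thesis
      using power_add[of x1 "t - s" s] power_add[of x2 "t - s" s] that
      by (simp add: u_def mult_ac)
  qed
  have neg: "m s t * (u s t - u t s) \<le> 0" if "s \<le> N" "t \<le> N" for s t
  proof (cases "s \<le> t")
    case True
    then show ?thesis
      using fg[of s t] u[of s t] that by (intro mult_nonpos_nonneg) (auto simp: m_def)
  next
    case False
    then show ?thesis
      using fg[of t s] u[of t s] that by (intro mult_nonneg_nonpos) (auto simp: m_def mult.commute)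
  qed
  let ?D = "\<Sum>s\<le>N. \<Sum>t\<le>N. m s t * u s t"
  have "?D = (\<Sum>s\<le>N. \<Sum>t\<le>N. m t s * u t s)"
    by (rule sum.swap)
  then have "2 * ?D = (\<Sum>s\<le>N. \<Sum>t\<le>N. m s t * (u s t - u t s))"
    by (simp add: m_def algebra_simps sum_subtractf sum.distrib)
  also have "\<dots> \<le> 0"
    using neg by (intro sum_nonpos) auto
  finally have "?D \<le> 0" by simp
  moreover have "(\<Sum>s\<le>N. f s * x1 ^ s) * (\<Sum>s\<le>N. g s * x2 ^ s) -
      (\<Sum>s\<le>N. g s * x1 ^ s) * (\<Sum>s\<le>N. f s * x2 ^ s) = ?D"
    unfolding sum_product sum_subtractf[symmetric]
    by (intro sum.cong refl) (simp add: m_def u_def algebra_simps)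
  ultimately show ?thesis by simp
qed

text \<open>The coefficient array \<open>A\<close> is reverse regular. The moment inequality is
  applied twice: in \<open>x\<close> for each pair of columns of \<open>A\<close>, then in
  \<open>y\<close> with the resulting sums as coefficients.\<close>

lemma hsym_reverse:
  fixes as :: "real list" and p q N :: nat
  assumes as: "\<And>w. w \<in> set as \<Longrightarrow> 0 \<le> w"
    and x: "0 \<le> x1" "x1 \<le> x2" and y: "0 \<le> y1" "y1 \<le> y2"
  defines "H \<equiv> \<lambda>x y. hsym (as @ replicate p x @ replicate q y) $ N"
  shows "H x1 y1 * H x2 y2 \<le> H x1 y2 * H x2 y1"
proof -
  define c where "c = (\<lambda>p k. (Abs_fps (\<lambda>_. 1 :: real) ^ p) $ k)"
  have c0: "0 \<le> c p k" for p k
    unfolding c_def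
  proof (induction p arbitrary: k)
    case (Suc p)
    then show ?case by (auto simp: fps_mult_nth intro!: sum_nonneg)
  qed simp
  define g where "g = (\<lambda>k. hsym as $ k)"
  have "pf2 g" unfolding g_def using as by (rule pf2_hsym)
  then have g0: "0 \<le> g i" and g: "i \<le> j \<Longrightarrow> g i * g (j + d) \<le> g (i + d) * g j" for i j d
    by (auto simp: pf2_def)
  \<comment> \<open>Extension by 0 beyond the triangle \<open>s + t \<le> N\<close> lets all sums
    run over a full square.\<close>
  define A where "A s t = (if s + t \<le> N then c p s * c q t * g (N - s - t) else 0)" for s t
  have A0: "0 \<le> A s t" for s t
    by (simp add: A_def c0 g0)
  have A: "A s t * A s' t' \<le> A s t' * A s' t" if "s \<le> s'" "t \<le> t'" for s s' t t'
  proof (cases "s' + t' \<le> N")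
    case True
    \<comment> \<open>Both index pairs have the same sum, and the pair on the left is the more
      spread out.\<close>
    have "g (N - s' - t') * g (N - s - t) \<le> g (N - s' - t) * g (N - s - t')"
      using g[of "N - s' - t'" "N - s - t'" "t' - t"] that True by simp
    then have "(c p s * c q t * c p s' * c q t') * (g (N - s' - t') * g (N - s - t)) \<le>
        (c p s * c q t * c p s' * c q t') * (g (N - s' - t) * g (N - s - t'))"
      by (intro mult_left_mono) (simp_all add: c0)
    then show ?thesis using True that by (simp add: A_def mult_ac)
  next
    case False
    then have "A s' t' = 0" by (simp add: A_def)
    then show ?thesis by (simp add: A0)
  qed
  have H: "H x y = (\<Sum>t\<le>N. (\<Sum>s\<le>N. A s t * x ^ s) * y ^ t)" for x y
  proof -
    have "H x y = (hsym (replicate q y) * (hsym (replicate p x) * hsym as)) $ N"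
      by (simp add: H_def hsym_append mult_ac)
    also have "\<dots> = (\<Sum>t\<le>N. \<Sum>s\<le>N-t. A s t * x ^ s * y ^ t)"
      unfolding fps_mult_nth sum_distrib_left atLeast0AtMost
      by (intro sum.cong refl)
        (auto simp: A_def c_def g_def hsym_replicate geometric_power_nth diff_commute add.commute)
    also have "\<dots> = (\<Sum>t\<le>N. \<Sum>s\<le>N. A s t * x ^ s * y ^ t)"
      by (intro sum.cong sum.mono_neutral_left refl) (auto simp: A_def)
    finally show ?thesis by (simp add: sum_distrib_right)
  qed
  have B: "(\<Sum>s\<le>N. A s t * x1 ^ s) * (\<Sum>s\<le>N. A s t' * x2 ^ s) \<le>
      (\<Sum>s\<le>N. A s t' * x1 ^ s) * (\<Sum>s\<le>N. A s t * x2 ^ s)" if "t \<le> t'" for t t'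
    using A that by (intro moment_kernel_reverse x) (auto simp: mult.commute)
  have "H x1 y1 * H x2 y2 \<le> H x2 y1 * H x1 y2"
    unfolding H using B by (intro moment_kernel_reverse y) (auto simp: mult.commute)
  then show ?thesis by (simp add: mult.commute)
qed

section \<open>Contour integrals for divided differences of powers\<close>

lemma prod_list_diff_holomorphic [holomorphic_intros]:
  "(\<lambda>z. \<Prod>w\<leftarrow>zs. z - w) holomorphic_on S" for zs :: "complex list"
  by (induction zs) (auto intro!: holomorphic_intros)

lemma prod_list_diff_nonzero:
  fixes zs :: "complex list"
  assumes "\<And>w. w \<in> set zs \<Longrightarrow> norm w < R" and "norm z = R"
  shows "(\<Prod>w\<leftarrow>zs. z - w) \<noteq> 0"
  using assms by (fastforce simp: prod_list_zero_iff)

lemma dd_integrable: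
  assumes "\<And>w. w \<in> set zs \<Longrightarrow> norm w < R" and "0 < R" and "f holomorphic_on UNIV"
  shows "(\<lambda>z. f z / (\<Prod>w\<leftarrow>zs. z - w)) contour_integrable_on circlepath 0 R"
proof (rule contour_integrable_continuous_circlepath)
  show "continuous_on (path_image (circlepath 0 R)) (\<lambda>z. f z / (\<Prod>w\<leftarrow>zs. z - w))"
    using assms prod_list_diff_nonzero[OF assms(1)]
    by (intro continuous_on_divide holomorphic_on_imp_continuous_on[OF holomorphic_on_subset[OF assms(3)]]
        holomorphic_on_imp_continuous_on prod_list_diff_holomorphic) auto
qed

text \<open>The residue sum is free of \<open>R\<close>, so any two circles around all nodes can be
  compared.\<close>

lemma dd_residues:
  assumes "\<And>w. w \<in> set zs \<Longrightarrow> norm w < R" and "0 < R"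
  shows "contour_integral (circlepath 0 R) (\<lambda>z. 1 / (\<Prod>w\<leftarrow>zs. z - w)) =
    2 * of_real pi * \<i> * (\<Sum>w\<in>set zs. residue (\<lambda>z. 1 / (\<Prod>w\<leftarrow>zs. z - w)) w)"
proof -
  have "(\<Prod>w\<leftarrow>zs. z - w) \<noteq> 0" if "z \<notin> set zs" for z
    using that by (auto simp: prod_list_zero_iff)
  then have "(\<lambda>z. 1 / (\<Prod>w\<leftarrow>zs. z - w)) holomorphic_on UNIV - set zs"
    by (intro holomorphic_intros) auto
  moreover have "path_image (circlepath 0 R) \<inter> set zs = {}"
    using assms by (fastforce simp: dist_norm)
  ultimately have "contour_integral (circlepath 0 R) (\<lambda>z. 1 / (\<Prod>w\<leftarrow>zs. z - w)) =
      2 * pi * \<i> * (\<Sum>w\<in>set zs. winding_number (circlepath 0 R) w *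
        residue (\<lambda>z. 1 / (\<Prod>w\<leftarrow>zs. z - w)) w)"
    by (intro Residue_theorem[of UNIV]) auto
  also have "(\<Sum>w\<in>set zs. winding_number (circlepath 0 R) w *
        residue (\<lambda>z. 1 / (\<Prod>w\<leftarrow>zs. z - w)) w) =
      (\<Sum>w\<in>set zs. residue (\<lambda>z. 1 / (\<Prod>w\<leftarrow>zs. z - w)) w)"
    using assms by (intro sum.cong refl) (simp add: winding_number_circlepath)
  finally show ?thesis by simp
qed

text \<open>The integral does not depend on the radius, and decays like its inverse.\<close>

lemma dd_one_eq_0:
  assumes R: "\<And>w. w \<in> set zs \<Longrightarrow> norm w < R" "0 < R" and len: "2 \<le> length zs"
  shows "contour_integral (circlepath 0 R) (\<lambda>z. 1 / (\<Prod>w\<leftarrow>zs. z - w)) = 0"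
    (is "?I = 0")
proof -
  have bound: "norm ?I \<le> 2 * pi * (R + t) / t\<^sup>2" if t: "t \<ge> 1" for t
  proof -
    have "norm (contour_integral (circlepath 0 (R + t)) (\<lambda>z. 1 / (\<Prod>w\<leftarrow>zs. z - w)))
        \<le> 1 / t\<^sup>2 * (2 * pi * (R + t))"
    proof (rule has_contour_integral_bound_circlepath)
      show "((\<lambda>z. 1 / (\<Prod>w\<leftarrow>zs. z - w)) has_contour_integral
          contour_integral (circlepath 0 (R + t)) (\<lambda>z. 1 / (\<Prod>w\<leftarrow>zs. z - w)))
          (circlepath 0 (R + t))"
        using R t by (intro has_contour_integral_integral dd_integrable)
          (fastforce intro: less_trans)+
      fix z :: complex assume z: "norm (z - 0) = R + t"
      \<comment> \<open>All nodes have norm below \<open>R\<close>, so each factor has norm at least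
        \<open>t\<close> on the circle of radius \<open>R + t\<close>. Two factors suffice to beat
        the length of the circle.\<close>
      have "t ^ length ws \<le> norm (\<Prod>w\<leftarrow>ws. z - w)" if "set ws \<subseteq> set zs" for ws
        using that
      proof (induction ws)
        case (Cons w ws)
        have "t \<le> norm (z - w)"
          using norm_triangle_ineq2[of z w] z R(1)[of w] Cons.prems by simp
        then show ?case
          using Cons t by (auto simp: norm_mult intro!: mult_mono)
      qed simp
      then have "t ^ length zs \<le> norm (\<Prod>w\<leftarrow>zs. z - w)" by simp
      moreover have "t\<^sup>2 \<le> t ^ length zs"
        using t len by (intro power_increasing) auto
      ultimately show "norm (1 / (\<Prod>w\<leftarrow>zs. z - w)) \<le> 1 / t\<^sup>2"
        using t by (simp add: norm_divide divide_left_mono frac_le)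
    qed (use R t in auto)
    also have "contour_integral (circlepath 0 (R + t)) (\<lambda>z. 1 / (\<Prod>w\<leftarrow>zs. z - w)) = ?I"
    proof -
      have "norm w < R + t" if "w \<in> set zs" for w
        using R(1)[OF that] t by simp
      then show ?thesis using R t by (simp add: dd_residues)
    qed
    finally show ?thesis by simp
  qed
  have "((\<lambda>t. 2 * pi * (R + t) / t\<^sup>2) \<longlongrightarrow> 0) at_top"
    by real_asymp
  moreover have "\<forall>\<^sub>F t in at_top. norm ?I \<le> 2 * pi * (R + t) / t\<^sup>2"
    using eventually_ge_at_top[of 1] by eventually_elim (rule bound)
  ultimately have "norm ?I \<le> 0"
    by (rule tendsto_lowerbound) simp
  then show ?thesis by simp
qed

lemma dd_one_single:
  assumes "norm w < R" and "0 < R"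
  shows "contour_integral (circlepath 0 R) (\<lambda>z. 1 / (z - w)) = 2 * of_real pi * \<i>"
  using dd_residues[of "[w]" R] residue_simple[of UNIV w "\<lambda>_. 1"] assms by simp

text \<open>The identity \<open>(1 + z/M) = (1 + w/M) + (z - w)/M\<close> gives divided differences of
  \<open>(1 + z/M)^j\<close> the recursion of complete homogeneous symmetric polynomials.\<close>

lemma dd_power:
  assumes R: "\<And>w. w \<in> set zs \<Longrightarrow> norm w < R" "0 < R" and M: "M \<noteq> 0"
  shows "contour_integral (circlepath 0 R) (\<lambda>z. (1 + z / M) ^ j / (\<Prod>w\<leftarrow>zs. z - w)) =
    (if zs = [] \<or> j + 1 < length zs then 0
     else 2 * of_real pi * \<i> * hsym (map (\<lambda>w. 1 + w / M) zs) $ (j + 1 - length zs)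
       / M ^ (length zs - 1))"
  using R(1)
proof (induction zs arbitrary: j)
  case Nil
  have "((\<lambda>z. (1 + z / M) ^ j) has_contour_integral 0) (circlepath 0 R)"
    using M by (intro Cauchy_theorem_convex_simple[of _ UNIV] holomorphic_intros) auto
  then show ?case by (simp add: contour_integral_unique)
next
  case (Cons w zs)
  let ?I = "\<lambda>zs j. contour_integral (circlepath 0 R) (\<lambda>z. (1 + z / M) ^ j / (\<Prod>w\<leftarrow>zs. z - w))"
  let ?h = "\<lambda>zs k. hsym (map (\<lambda>w. 1 + w / M) zs) $ k"
  have step: "?I (w # zs) (Suc j) = (1 + w / M) * ?I (w # zs) j + ?I zs j / M" for j
  proof -
    have int: "(\<lambda>z. (1 + z / M) ^ j / (\<Prod>w\<leftarrow>ws. z - w)) contour_integrable_on circlepath 0 R"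
      if "set ws \<subseteq> set (w # zs)" for ws
      using that Cons.prems R(2) M by (intro dd_integrable holomorphic_intros) auto
    have "?I (w # zs) (Suc j) = contour_integral (circlepath 0 R)
        (\<lambda>z. (1 + w / M) * ((1 + z / M) ^ j / (\<Prod>w\<leftarrow>w # zs. z - w))
           + (1 / M) * ((1 + z / M) ^ j / (\<Prod>w\<leftarrow>zs. z - w)))"
    proof (rule contour_integral_cong[OF refl])
      fix z assume "z \<in> path_image (circlepath 0 R)"
      then have "norm z = R" using R(2) by simp
      then have "(\<Prod>w\<leftarrow>w # zs. z - w) \<noteq> 0"
        using prod_list_diff_nonzero[of "w # zs" R z] Cons.prems by blast
      then have "z - w \<noteq> 0" "(\<Prod>w\<leftarrow>zs. z - w) \<noteq> 0" by auto
      have "(1 + z / M) * P / ((z - w) * Q) =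
          (1 + w / M) * (P / ((z - w) * Q)) + (1 / M) * (P / Q)" if "Q \<noteq> 0" for P Q
        using that \<open>z - w \<noteq> 0\<close> M by (simp add: divide_simps) (simp add: algebra_simps)
      from this[OF \<open>(\<Prod>w\<leftarrow>zs. z - w) \<noteq> 0\<close>] show "(1 + z / M) ^ Suc j / (\<Prod>w\<leftarrow>w # zs. z - w) =
          (1 + w / M) * ((1 + z / M) ^ j / (\<Prod>w\<leftarrow>w # zs. z - w))
           + (1 / M) * ((1 + z / M) ^ j / (\<Prod>w\<leftarrow>zs. z - w))"
        by simp
    qed
    also have "\<dots> = (1 + w / M) * ?I (w # zs) j + (1 / M) * ?I zs j"
    proof -
      have 1: "(\<lambda>z. (1 + z / M) ^ j / (\<Prod>w\<leftarrow>w # zs. z - w)) contour_integrable_on circlepath 0 R"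
        and 2: "(\<lambda>z. (1 + z / M) ^ j / (\<Prod>w\<leftarrow>zs. z - w)) contour_integrable_on circlepath 0 R"
        by (rule int, force)+
      show ?thesis
        by (simp only: contour_integral_add[OF contour_integrable_lmul[OF 1] contour_integrable_lmul[OF 2]]
            contour_integral_lmul[OF 1] contour_integral_lmul[OF 2])
    qed
    finally show ?thesis by simp
  qed
  \<comment> \<open>A constant has vanishing divided differences of positive order.\<close>
  have base: "?I (w # zs) 0 = (if zs = [] then 2 * of_real pi * \<i> else 0)"
    using dd_one_eq_0[of "w # zs" R] dd_one_single[of w R] Cons.prems R(2)
    by (cases zs) auto
  have IH: "?I zs j = (if zs = [] \<or> j + 1 < length zs then 0
     else 2 * of_real pi * \<i> * ?h zs (j + 1 - length zs) / M ^ (length zs - 1))" for j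
    using Cons by simp
  show ?case
  proof (induction j)
    case 0
    then show ?case using base by (auto simp: hsym_Cons)
  next
    case (Suc j)
    \<comment> \<open>The cases follow the truncated subtraction in the coefficient index. When
      \<open>Suc j = length zs\<close>, the integral over \<open>w # zs\<close> at \<open>j\<close>
      still vanishes and only coefficient 0 of \<open>zs\<close> contributes.\<close>
    consider "zs = []" | "zs \<noteq> []" "Suc j < length zs" | "zs \<noteq> []" "Suc j = length zs"
      | "zs \<noteq> []" "length zs \<le> j"
      by linarith
    then show ?case
    proof cases
      case 1
      then show ?thesis unfolding step IH Suc by (simp add: hsym_Cons_Suc)
    next
      case 2
      then show ?thesis unfolding step IH Suc by simp
    next
      case 3
      then have j: "length zs = Suc j" by simp
      show ?thesis unfolding step IH Suc using 3(1) j M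
        by (cases j) (simp_all add: hsym_Cons_0)
    next
      case 4
      obtain l where l: "length zs = Suc l" using 4(1) by (cases zs) auto
      define k where "k = j - length zs"
      have k: "j = k + Suc l" using 4 l by (simp add: k_def)
      have "?h (w # zs) (Suc k) = (1 + w / M) * ?h (w # zs) k + ?h zs (Suc k)"
        by (simp add: hsym_Cons_Suc)
      moreover have "c * (u * s + t) / d = u * (c * s) / d + c * t / d" for c d s t u :: complex
        by (simp add: algebra_simps add_divide_distrib)
      ultimately show ?thesis unfolding step IH Suc using 4(1) l k M
        by (simp add: mult.commute[of M "M ^ l"])
    qed
  qed
qed

section \<open>Passage from powers to the exponential\<close>

text \<open>With \<open>u = z / n\<close>, the bases \<open>1 + u\<close> and \<open>exp u\<close>
  differ by \<open>O(1 / n^2)\<close>, and taking \<open>n\<close>-th powers costs a factor of order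
  \<open>n\<close>. The total error is \<open>O(1 / n)\<close>, uniformly on the circle.\<close>

lemma uniform_limit_exp:
  assumes "0 < R"
  shows "uniform_limit (sphere 0 R) (\<lambda>n z :: complex. (1 + z / of_nat n) ^ n) exp sequentially"
proof -
  have bound: "norm ((1 + z / of_nat n) ^ n - exp z) \<le> exp R * exp R * R\<^sup>2 / real n"
    if n: "n > 0" and z: "norm z = R" for n and z :: complex
  proof -
    define u where "u = z / of_nat n"
    define s where "s = exp (R / real n)"
    have u: "norm u = R / real n" using z by (simp add: u_def norm_divide)
    have s: "1 \<le> s" "s ^ n = exp R"
      using assms n by (simp_all add: s_def flip: exp_of_nat_mult)
    have 1: "norm (exp u) \<le> s"
      using norm_exp[of u] u by (simp add: s_def)
    have "norm (1 + u) \<le> 1 + R / real n"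
      using norm_triangle_ineq[of 1 u] u by simp
    also have "\<dots> \<le> s"
      unfolding s_def by (rule exp_ge_add_one_self)
    finally have 2: "norm (1 + u) \<le> s" .
    have "\<bar>Re u\<bar> \<le> R / real n" using abs_Re_le_cmod[of u] u by simp
    also have "\<dots> \<le> R" using assms n by (simp add: field_simps)
    finally have "exp \<bar>Re u\<bar> \<le> exp R" by simp
    then have 3: "norm (exp u - (1 + u)) \<le> exp R * (R / real n)\<^sup>2"
    proof -
      have "norm (exp u - (1 + u)) \<le> exp \<bar>Re u\<bar> * (norm u)\<^sup>2"
        using Taylor_exp[of u 1] by (simp add: numeral_2_eq_2)
      also have "\<dots> \<le> exp R * (norm u)\<^sup>2"
        using \<open>exp \<bar>Re u\<bar> \<le> exp R\<close> by (intro mult_right_mono) auto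
      finally show ?thesis using u by simp
    qed
    have "exp u ^ n = exp z"
      using n by (simp add: u_def flip: exp_of_nat_mult)
    \<comment> \<open>Division by \<open>s\<close> moves both bases into the unit disc, where
      \<open>n\<close>-th powers differ by at most \<open>n\<close> times the distance of the bases.
      The price \<open>s ^ n = exp R\<close> is independent of \<open>n\<close>.\<close>
    then have "(1 + u) ^ n - exp z =
        of_real s ^ n * (((1 + u) / of_real s) ^ n - (exp u / of_real s) ^ n)"
      using s(1) by (simp add: power_divide right_diff_distrib)
    then have "norm ((1 + u) ^ n - exp z) =
        exp R * norm (((1 + u) / of_real s) ^ n - (exp u / of_real s) ^ n)"
      using s by (simp add: norm_mult norm_power flip: of_real_power)
    also have "\<dots> \<le> exp R * (real n * norm ((1 + u) / of_real s - exp u / of_real s))"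
      using 1 2 s(1) by (intro mult_left_mono norm_power_diff) (simp_all add: norm_divide)
    also have "\<dots> \<le> exp R * (real n * (exp R * (R / real n)\<^sup>2))"
    proof (intro mult_left_mono)
      have "norm ((1 + u) / of_real s - exp u / of_real s) = norm (exp u - (1 + u)) / s"
        using s(1) norm_minus_commute[of "1 + u" "exp u"]
        by (simp add: norm_divide flip: diff_divide_distrib)
      also have "\<dots> \<le> norm (exp u - (1 + u)) / 1"
        using s(1) by (intro divide_left_mono) simp_all
      finally show "norm ((1 + u) / of_real s - exp u / of_real s) \<le> exp R * (R / real n)\<^sup>2"
        using 3 by simp
    qed simp_all
    also have "\<dots> = exp R * exp R * R\<^sup>2 / real n"
      using n by (simp add: power2_eq_square)
    finally show ?thesis
      by (simp add: u_def)
  qed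
  show ?thesis
  proof (rule uniform_limitI)
    fix e :: real assume "e > 0"
    have "(\<lambda>n. exp R * exp R * R\<^sup>2 / real n) \<longlonglongrightarrow> 0" by real_asymp
    then have "\<forall>\<^sub>F n in sequentially. exp R * exp R * R\<^sup>2 / real n < e"
      using \<open>e > 0\<close> by (rule order_tendstoD)
    then have "\<forall>\<^sub>F n in sequentially. n > 0 \<and> exp R * exp R * R\<^sup>2 / real n < e"
      using eventually_gt_at_top[of "0 :: nat"] by (simp add: eventually_conj_iff)
    moreover have "dist ((1 + z / of_nat n) ^ n) (exp z) < e"
      if "n > 0 \<and> exp R * exp R * R\<^sup>2 / real n < e" "z \<in> sphere 0 R" for n and z :: complex
      using bound[of n z] that by (simp add: dist_norm)
    ultimately show "\<forall>\<^sub>F n in sequentially. \<forall>z\<in>sphere 0 R.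
        dist ((1 + z / of_nat n) ^ n) (exp z :: complex) < e"
      by (auto elim: eventually_mono)
  qed
qed

text \<open>The reciprocal node product is bounded on the circle, so uniform convergence of the
  numerators passes to the integrals, which \<open>dd_power\<close> evaluates.\<close>

lemma exp_dd_limit:
  assumes "zs \<noteq> []"
  shows "(\<lambda>n. hsym (map (\<lambda>w. 1 + w / of_nat n) zs) $ (n + 1 - length zs)
    / of_nat n ^ (length zs - 1)) \<longlonglongrightarrow> exp_dd zs"
proof -
  define R where "R = 1 + (\<Sum>w\<leftarrow>zs. norm w)"
  have R: "\<And>w. w \<in> set zs \<Longrightarrow> norm w < R" "0 < R"
    unfolding R_def using norm_less_exp_dd_radius exp_dd_radius_pos by blast+
  let ?P = "\<lambda>z. 1 / (\<Prod>w\<leftarrow>zs. z - w)"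
  let ?f = "\<lambda>n z. (1 + z / of_nat n) ^ n"
  have "continuous_on (sphere 0 R) ?P"
    using prod_list_diff_nonzero[OF R(1)]
    by (intro holomorphic_on_imp_continuous_on holomorphic_intros) auto
  then have bP: "bounded (?P ` sphere 0 R)"
    by (intro compact_imp_bounded compact_continuous_image) auto
  have bexp: "bounded (exp ` sphere 0 R :: complex set)"
    by (intro compact_imp_bounded compact_continuous_image continuous_intros) auto
  have "uniform_limit (sphere 0 R) (\<lambda>n z. ?f n z * ?P z) (\<lambda>z. exp z * ?P z) sequentially"
    by (intro uniform_lim_mult uniform_limit_exp uniform_limit_const R(2) bP bexp)
  then have ul: "uniform_limit (sphere 0 R) (\<lambda>n z. ?f n z / (\<Prod>w\<leftarrow>zs. z - w))
      (\<lambda>z. exp z / (\<Prod>w\<leftarrow>zs. z - w)) sequentially" by simp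
  have "(\<lambda>z. ?f n z / (\<Prod>w\<leftarrow>zs. z - w)) contour_integrable_on circlepath 0 R" if "n > 0" for n
    using that R by (intro dd_integrable holomorphic_intros) auto
  then have "\<forall>\<^sub>F n in sequentially.
      (\<lambda>z. ?f n z / (\<Prod>w\<leftarrow>zs. z - w)) contour_integrable_on circlepath 0 R"
    using eventually_gt_at_top[of 0] by (rule eventually_mono[rotated])
  from contour_integral_uniform_limit_circlepath(2)[OF this ul _ R(2)]
  have "(\<lambda>n. 1 / (2 * of_real pi * \<i>) * contour_integral (circlepath 0 R)
      (\<lambda>z. ?f n z / (\<Prod>w\<leftarrow>zs. z - w))) \<longlonglongrightarrow> exp_dd zs"
    unfolding exp_dd_def R_def[symmetric] by (intro tendsto_mult_left) auto
  moreover have "\<forall>\<^sub>F n in sequentially. 1 / (2 * of_real pi * \<i>) *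
      contour_integral (circlepath 0 R) (\<lambda>z. ?f n z / (\<Prod>w\<leftarrow>zs. z - w)) =
      hsym (map (\<lambda>w. 1 + w / of_nat n) zs) $ (n + 1 - length zs) / of_nat n ^ (length zs - 1)"
    \<comment> \<open>For such \<open>n\<close> the scale is nonzero and the vanishing case of
      \<open>dd_power\<close> is excluded.\<close>
    using eventually_gt_at_top[of "length zs"]
  proof eventually_elim
    case (elim n)
    then have "of_nat n \<noteq> (0 :: complex)" by auto
    then show ?case
      using elim assms by (subst dd_power[OF R]) auto
  qed
  ultimately show ?thesis
    by (rule Lim_transform_eventually)
qed

lemma exp_dd_real_limit:
  assumes "zs \<noteq> []"
  shows "(\<lambda>n. hsym (map (\<lambda>w. 1 + w / real n) zs) $ (n + 1 - length zs)
    / real n ^ (length zs - 1)) \<longlonglongrightarrow> exp_dd_real zs"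
proof -
  have "map (\<lambda>w. 1 + w / of_nat n) (map of_real zs) =
      (map of_real (map (\<lambda>w. 1 + w / real n) zs) :: complex list)" for n
    by simp
  with exp_dd_limit[of "map of_real zs"] assms
  have "(\<lambda>n. of_real (hsym (map (\<lambda>w. 1 + w / real n) zs) $ (n + 1 - length zs)
      / real n ^ (length zs - 1))) \<longlonglongrightarrow> (of_real (exp_dd_real zs) :: complex)"
    by (simp add: of_real_exp_dd_real hsym_of_real del: map_map)
  then show ?thesis by (simp only: tendsto_of_real_iff)
qed

theorem theorem1:
  fixes n p q :: nat and a :: "nat \<Rightarrow> real" and x1 x2 y1 y2 :: real
  assumes "mono_on {1..n} a"
    and "p \<ge> 1" and "q \<ge> 1"
    and "x1 \<le> x2" and "y1 \<le> y2"
  shows "K n a p q x1 y1 * K n a p q x2 y2 \<le> K n a p q x1 y2 * K n a p q x2 y1"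
proof -
  define as where "as = map a [1..<Suc n]"
  define m where "m = n + p + q"
  define f where "f N w = 1 + w / real N" for N w
  define H where "H N x y = hsym (map (f N) as @ replicate p (f N x) @ replicate q (f N y)) $ (N + 1 - m)
    / real N ^ (m - 1)" for N x y
  have lim: "(\<lambda>N. H N x y) \<longlonglongrightarrow> K n a p q x y" for x y
  proof -
    have "length (as @ replicate p x @ replicate q y) = m"
      unfolding as_def m_def by (simp del: upt_Suc)
    then show ?thesis
      using exp_dd_real_limit[of "as @ replicate p x @ replicate q y"] \<open>p \<ge> 1\<close>
      by (simp add: H_def K_def as_def f_def[abs_def] del: upt_Suc length_append)
  qed
  have pos: "\<forall>\<^sub>F N in sequentially. 0 \<le> f N w" for w
  proof -
    have "(\<lambda>N. f N w) \<longlonglongrightarrow> 1" unfolding f_def by real_asymp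
    then have "\<forall>\<^sub>F N in sequentially. 0 < f N w" by (rule order_tendstoD) simp
    then show ?thesis by (rule eventually_mono) simp
  qed
  have "\<forall>\<^sub>F N in sequentially. \<forall>w\<in>set as. 0 \<le> f N w"
    using pos by (simp add: eventually_ball_finite)
  then have "\<forall>\<^sub>F N in sequentially. H N x1 y1 * H N x2 y2 \<le> H N x1 y2 * H N x2 y1"
    using pos[of x1] pos[of y1]
  proof eventually_elim
    case (elim N)
    have "f N x1 \<le> f N x2" "f N y1 \<le> f N y2"
      using assms by (simp_all add: f_def divide_right_mono)
    \<comment> \<open>All four values of \<open>H N\<close> share the denominator
      \<open>real N ^ (m - 1)\<close>, so the claim reduces to the numerators.\<close>
    with elim show ?case
      unfolding H_def times_divide_times_eq
      by (intro divide_right_mono hsym_reverse) auto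
  qed
  then show ?thesis
    by (intro tendsto_le[OF _ tendsto_mult[OF lim lim] tendsto_mult[OF lim lim]]) auto
qed

end
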